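(* Every finite simple graph $G$ with maximum degree at most $3$ admits a $2$-labelling $\ell$ such that, for every $x \geq 1$, the subgraph of $G$ induced by $S_x = \{v \in V(G) : \rho_\ell(v) = x\}$ is a forest.
   Context: A $2$-labelling of a graph $G$ is a map $\ell: E(G) \to \{1,2\}$. For a vertex $v$, $\rho_\ell(v)$ denotes the product of the labels $\ell(uv)$ over all edges $uv$ incident to $v$ (the empty product being $1$). *)

theory Defs
  imports "Graph_Theory.Graph_Theory"
begin

text \<open>
  Finite simple graphs are the \<^locale>\<open>pair_graph\<close>s: finite, loopless, symmetric digraphs without
  parallel arcs. An undirected edge is the unordered pair of endpoints, so that an edge
  labelling automatically gives both orientations the same label.
\<close>

definition edges :: "'a pair_pre_digraph \<Rightarrow> 'a set set" where
  "edges G = {{u, v} | u v. (u, v) \<in> parcs G}"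

definition incident_edges :: "'a pair_pre_digraph \<Rightarrow> 'a \<Rightarrow> 'a set set" where
  "incident_edges G v = {e \<in> edges G. v \<in> e}"

lemma out_degree_eq_card_incident_edges:
  assumes "pair_graph G"
  shows "out_degree (with_proj G) v = card (incident_edges G v)"
proof -
  interpret pair_graph G by fact
  have sym: "(a, b) \<in> parcs G \<Longrightarrow> (b, a) \<in> parcs G" for a b
    using pair_sym_arcs by (auto simp: symmetric_def sym_def)
  have "bij_betw (\<lambda>(a, b). {a, b}) (out_arcs (with_proj G) v) (incident_edges G v)"
    unfolding bij_betw_def inj_on_def incident_edges_def edges_def out_arcs_def
    by (auto simp: doubleton_eq_iff image_iff insert_commute dest: sym)
  then show ?thesis
    unfolding out_degree_def by (rule bij_betw_same_card)
qed

text \<open>On \<^typ>\<open>nat\<close> the supremum of the empty set is 0, so the graph without vertices has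
  maximum degree 0.\<close>

definition max_degree :: "'a pair_pre_digraph \<Rightarrow> nat" where
  "max_degree G = (SUP v\<in>pverts G. out_degree (with_proj G) v)"

text \<open>
  The library's \<^const>\<open>forest\<close> counts the closed walk \<open>u, v, u\<close> as a cycle, so a symmetric digraph
  with an edge never satisfies it. In a symmetric digraph without loops and parallel arcs, the
  cycles of the underlying undirected graph are the directed cycles of length at least 3.
\<close>

definition undirected_forest :: "('a, 'b) pre_digraph \<Rightarrow> bool" where
  "undirected_forest G \<longleftrightarrow> \<not> (\<exists>p. pre_digraph.cycle G p \<and> length p \<ge> 3)"

definition two_labelling :: "'a pair_pre_digraph \<Rightarrow> ('a set \<Rightarrow> nat) \<Rightarrow> bool" where
  "two_labelling G l \<longleftrightarrow> (\<forall>e\<in>edges G. l e \<in> {1, 2})"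

definition label_product :: "'a pair_pre_digraph \<Rightarrow> ('a set \<Rightarrow> nat) \<Rightarrow> 'a \<Rightarrow> nat" where
  "label_product G l v = (\<Prod>e\<in>incident_edges G v. l e)"

definition product_class :: "'a pair_pre_digraph \<Rightarrow> ('a set \<Rightarrow> nat) \<Rightarrow> nat \<Rightarrow> 'a set" where
  "product_class G l x = {v \<in> pverts G. label_product G l v = x}"

end

theory Submission
  imports Defs
begin

text \<open>
  Replace the labels 1, 2 by 0, 1, so that the vertex products become sums. A monochromatic cycle
  is a set of vertices each of which has two neighbours in the set with its own sum; call such a
  set a core. Choose a labelling whose largest core \<open>M\<close> is as small as possible and suppose that
  \<open>M\<close> is nonempty. If a change of labels puts no vertex whose sum changes into the new largest
  core, then the new largest core is a subset of the old one; since every vertex has at most three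
  neighbours, this is guaranteed as soon as each changed vertex has two neighbours with other sums.
  Flipping two edges \<open>uv\<close>, \<open>vw\<close> inside \<open>M\<close> succeeds unless they have equal labels and \<open>u\<close>, \<open>w\<close> are
  adjacent. In the remaining case of a triangle in \<open>M\<close>, a flip of the edge \<open>ab\<close> can only fail because
  the third neighbours \<open>a'\<close> and \<open>b'\<close> have sums that differ by 1 from those in the triangle; but then,
  if \<open>a' \<noteq> b'\<close>, flipping \<open>aa'\<close> succeeds. Hence the triangle lies in a \<open>K\<^sub>4\<close> whose vertex sums add up
  to an odd number, which is impossible.
\<close>

section \<open>Subcubic graphs, edge labels 0 and 1, and cores\<close>

locale subcubic =
  fixes N :: "'a \<Rightarrow> 'a set"
  assumes finite_support: "finite {v. N v \<noteq> {}}"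
    and sym: "u \<in> N v \<Longrightarrow> v \<in> N u"
    and irrefl: "v \<notin> N v"
    and finite_N: "finite (N v)"
    and card_N: "card (N v) \<le> 3"
begin

definition binary :: "('a set \<Rightarrow> int) \<Rightarrow> bool" where
  "binary h \<longleftrightarrow> (\<forall>e. h e \<in> {0, 1})"

definition wt :: "('a set \<Rightarrow> int) \<Rightarrow> 'a \<Rightarrow> int" where
  "wt h v = (\<Sum>u\<in>N v. h {v, u})"

definition flip :: "'a \<Rightarrow> 'a \<Rightarrow> ('a set \<Rightarrow> int) \<Rightarrow> 'a set \<Rightarrow> int" where
  "flip u v h = h({u, v} := 1 - h {u, v})"

definition same :: "('a set \<Rightarrow> int) \<Rightarrow> 'a \<Rightarrow> 'a set" where
  "same h v = {u \<in> N v. wt h u = wt h v}"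

definition core :: "('a set \<Rightarrow> int) \<Rightarrow> 'a set \<Rightarrow> bool" where
  "core h S \<longleftrightarrow> (\<forall>x\<in>S. \<exists>a b. a \<noteq> b \<and> a \<in> S \<inter> same h x \<and> b \<in> S \<inter> same h x)"

text \<open>Cores are closed under union, so this is the largest core.\<close>

definition max_core :: "('a set \<Rightarrow> int) \<Rightarrow> 'a set" where
  "max_core h = \<Union>{S. core h S}"

lemma core_subset: "core h S \<Longrightarrow> S \<subseteq> max_core h"
  by (auto simp: max_core_def)

lemma core_max_core: "core h (max_core h)"
  unfolding core_def max_core_def by blast

lemma max_coreE:
  assumes "v \<in> max_core h"
  obtains a b where "a \<noteq> b" "a \<in> max_core h" "a \<in> same h v" "b \<in> max_core h" "b \<in> same h v"
  using core_max_core[of h] assms unfolding core_def by blast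

lemma finite_max_core: "finite (max_core h)"
proof (rule finite_subset[OF _ finite_support])
  show "max_core h \<subseteq> {v. N v \<noteq> {}}"
    using core_max_core[of h] by (fastforce simp: core_def same_def)
qed

lemma binary_flip: "binary h \<Longrightarrow> binary (flip u v h)"
  by (auto simp: binary_def flip_def)

lemma wt_flip:
  assumes "v \<in> N u"
  shows "wt (flip u v h) x = wt h x + (if x = u \<or> x = v then 1 - 2 * h {u, v} else 0)"
proof -
  have uv: "u \<noteq> v" using assms irrefl by auto
  have "wt (flip u v h) x = (\<Sum>y\<in>N x. h {x, y} + (if {x, y} = {u, v} then 1 - 2 * h {u, v} else 0))"
    unfolding wt_def flip_def by (intro sum.cong) auto
  also have "\<dots> = wt h x + (\<Sum>y\<in>N x. if {x, y} = {u, v} then 1 - 2 * h {u, v} else 0)"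
    by (simp add: wt_def sum.distrib)
  \<comment> \<open>At most one neighbour of \<open>x\<close> completes the edge
    \<open>{u, v}\<close>, so the sum collapses. For \<open>x\<close> outside \<open>{u, v}\<close>
    the index \<open>u\<close> is a dummy, because the summand is then 0.\<close>
  also have "(\<Sum>y\<in>N x. if {x, y} = {u, v} then 1 - 2 * h {u, v} else 0)
      = (\<Sum>y\<in>N x. if y = (if x = u then v else u) then
          (if x = u \<or> x = v then 1 - 2 * h {u, v} else 0) else 0)"
    using uv by (intro sum.cong) (auto simp: doubleton_eq_iff)
  also have "\<dots> = (if x = u \<or> x = v then 1 - 2 * h {u, v} else 0)"
    using assms sym[OF assms] finite_N by (auto simp: sum.delta)
  finally show ?thesis .
qed

lemma N_eq_three:
  assumes "a \<in> N v" "b \<in> N v" "c \<in> N v" "distinct [a, b, c]"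
  shows "N v = {a, b, c}"
proof -
  have "{a, b, c} = N v"
    by (rule card_seteq[OF finite_N]) (use assms card_N[of v] in auto)
  then show ?thesis ..
qed

text \<open>Membership would give \<open>x\<close> two neighbours with its own sum. Together with
  \<open>p\<close> and \<open>q\<close> these would be four distinct neighbours.\<close>

lemma not_in_max_core:
  assumes "p \<in> N x" "q \<in> N x" "p \<noteq> q" "wt h p \<noteq> wt h x" "wt h q \<noteq> wt h x"
  shows "x \<notin> max_core h"
proof
  assume "x \<in> max_core h"
  then obtain a b where "a \<noteq> b" "a \<in> same h x" "b \<in> same h x"
    by (rule max_coreE)
  then have "{p, q, a, b} \<subseteq> N x" and card: "card {p, q, a, b} = 4"
    using assms by (auto simp: same_def card_insert_if)
  then have "card {p, q, a, b} \<le> card (N x)"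
    by (intro card_mono finite_N)
  then show False
    using card_N[of x] card by simp
qed

definition optimal :: "('a set \<Rightarrow> int) \<Rightarrow> bool" where
  "optimal h \<longleftrightarrow> binary h \<and> (\<forall>h'. binary h' \<longrightarrow> card (max_core h) \<le> card (max_core h'))"

lemma optimal_exists: "\<exists>h. optimal h"
proof -
  have "binary (\<lambda>_. 0)" by (simp add: binary_def)
  then show ?thesis
    unfolding optimal_def using ex_has_least_nat[of binary _ "\<lambda>h. card (max_core h)"] by blast
qed

text \<open>If \<open>max_core h'\<close> avoided \<open>D\<close>, all sums on it would be
  unchanged, so it would be a core of \<open>h\<close> without \<open>z\<close>, hence strictly
  smaller than \<open>max_core h\<close>.\<close>

lemma optimal_change:
  assumes opt: "optimal h" and "binary h'"
    and eq: "\<And>x. x \<notin> D \<Longrightarrow> wt h' x = wt h x"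
    and D: "z \<in> D" "z \<in> max_core h"
  shows "\<exists>x\<in>D. x \<in> max_core h'"
proof (rule ccontr)
  assume no: "\<not> ?thesis"
  have "core h (max_core h')"
    unfolding core_def
  proof
    fix x assume x: "x \<in> max_core h'"
    then obtain a b where ab: "a \<noteq> b" "a \<in> max_core h'" "a \<in> same h' x"
        "b \<in> max_core h'" "b \<in> same h' x"
      by (rule max_coreE)
    then have "x \<notin> D" "a \<notin> D" "b \<notin> D" using no x by auto
    then have "a \<in> same h x" "b \<in> same h x"
      using ab eq by (auto simp: same_def)
    with ab show "\<exists>a b. a \<noteq> b \<and> a \<in> max_core h' \<inter> same h x \<and> b \<in> max_core h' \<inter> same h x"
      by blast
  qed
  then have "max_core h' \<subset> max_core h"
    using core_subset no D by blast
  then have "card (max_core h') < card (max_core h)"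
    by (rule psubset_card_mono[OF finite_max_core])
  then show False using opt \<open>binary h'\<close> by (auto simp: optimal_def not_le[symmetric])
qed

section \<open>Flipping two edges inside the largest core\<close>

lemma other_same:
  assumes "u \<in> max_core h"
  obtains t where "t \<in> max_core h" "t \<in> same h u" "t \<noteq> v"
  using assms by (metis max_coreE)

lemma wt_flip_flip:
  assumes "u \<in> N v" "w \<in> N v" "u \<noteq> w"
  shows "wt (flip v u (flip v w h)) x = wt h x
    + (if x = v \<or> x = u then 1 - 2 * h {v, u} else 0)
    + (if x = v \<or> x = w then 1 - 2 * h {v, w} else 0)"
proof -
  have "flip v w h {v, u} = h {v, u}"
    using assms irrefl by (auto simp: flip_def doubleton_eq_iff)
  with assms show ?thesis by (simp add: wt_flip)
qed

lemma binaryD: "binary h \<Longrightarrow> h e = 0 \<or> h e = 1"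
  by (auto simp: binary_def)

text \<open>With different labels, flipping both edges keeps the sum of \<open>v\<close> and shifts
  those of \<open>u\<close> and \<open>w\<close> by opposite amounts. Each of \<open>u\<close> and
  \<open>w\<close> then differs from \<open>v\<close> and from its other partner \<open>t\<close>,
  even if \<open>t\<close> is the other one of the two, so both leave the core.\<close>

lemma optimal_same_label:
  assumes opt: "optimal h" and v: "u \<in> max_core h" "w \<in> max_core h" 
    and uw: "u \<in> same h v" "w \<in> same h v" "u \<noteq> w"
  shows "h {v, u} = h {v, w}"
proof (rule ccontr)
  assume ne: "h {v, u} \<noteq> h {v, w}"
  have bin: "binary h" using opt by (simp add: optimal_def)
  let ?h = "flip v u (flip v w h)"
  have N: "u \<in> N v" "w \<in> N v" "wt h u = wt h v" "wt h w = wt h v"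
    using uw by (auto simp: same_def)
  have neq: "v \<noteq> u" "v \<noteq> w" using N irrefl by auto
  define k where "k = 1 - 2 * h {v, w}"
  have nz: "k \<noteq> 0" using binaryD[OF bin, of "{v, w}"] by (auto simp: k_def)
  have opp: "1 - 2 * h {v, u} = - k"
    using ne binaryD[OF bin, of "{v, u}"] binaryD[OF bin, of "{v, w}"] by (auto simp: k_def)
  have wt: "wt ?h x = wt h x + (if x = u then - k else 0) + (if x = w then k else 0)" for x
    using wt_flip_flip[OF N(1,2) uw(3), of h x] neq uw(3) unfolding opp k_def[symmetric] by auto
  have wtD: "wt ?h x = wt h x" if "x \<notin> {u, w}" for x
    using that by (auto simp: wt)
  have "\<exists>x\<in>{u, w}. x \<in> max_core ?h"
    by (rule optimal_change[OF opt _ wtD, where z = u]) (use v bin in \<open>auto intro: binary_flip\<close>)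
  moreover have "u \<notin> max_core ?h"
  proof -
    obtain t where t: "t \<in> same h u" "t \<noteq> v" using other_same[OF v(1)] by metis
    have "t \<noteq> u" using t irrefl by (auto simp: same_def)
    then show ?thesis
      using t N neq nz uw by (intro not_in_max_core[of v _ t]) (auto simp: wt same_def intro: sym)
  qed
  moreover have "w \<notin> max_core ?h"
  proof -
    obtain t where t: "t \<in> same h w" "t \<noteq> v" using other_same[OF v(2)] by metis
    have "t \<noteq> w" using t irrefl by (auto simp: same_def)
    then show ?thesis
      using t N neq nz uw by (intro not_in_max_core[of v _ t]) (auto simp: wt same_def intro: sym)
  qed
  ultimately show False by blast
qed

text \<open>The labels agree, so flipping both edges shifts \<open>v\<close> by \<open>2 * k\<close>
  and \<open>u\<close>, \<open>w\<close> by \<open>k\<close>. Without an edge between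
  \<open>u\<close> and \<open>w\<close>, the partner \<open>t\<close> of either one other than
  \<open>v\<close> keeps its sum, so \<open>u\<close>, \<open>v\<close> and \<open>w\<close> would
  all leave the core.\<close>

lemma optimal_adjacent:
  assumes opt: "optimal h" and v: "u \<in> max_core h" "w \<in> max_core h" 
    and uw: "u \<in> same h v" "w \<in> same h v" "u \<noteq> w"
  shows "u \<in> N w"
proof (rule ccontr)
  assume nadj: "u \<notin> N w"
  then have nadj': "w \<notin> N u" using sym by blast
  have bin: "binary h" using opt by (simp add: optimal_def)
  let ?h = "flip v u (flip v w h)"
  have N: "u \<in> N v" "w \<in> N v" "wt h u = wt h v" "wt h w = wt h v"
    using uw by (auto simp: same_def)
  have neq: "v \<noteq> u" "v \<noteq> w" using N irrefl by auto
  define k where "k = 1 - 2 * h {v, w}"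
  have nz: "k \<noteq> 0" using binaryD[OF bin, of "{v, w}"] by (auto simp: k_def)
  have eq: "1 - 2 * h {v, u} = k"
    using optimal_same_label[OF opt v uw] by (simp add: k_def)
  have wt: "wt ?h x = wt h x + (if x = v then 2 * k else 0) + (if x = u \<or> x = w then k else 0)" for x
    using wt_flip_flip[OF N(1,2) uw(3), of h x] neq uw(3) unfolding eq k_def[symmetric] by auto
  have wtD: "wt ?h x = wt h x" if "x \<notin> {u, v, w}" for x
    using that by (auto simp: wt)
  have "\<exists>x\<in>{u, v, w}. x \<in> max_core ?h"
    by (rule optimal_change[OF opt _ wtD, where z = u]) (use v bin in \<open>auto intro: binary_flip\<close>)
  moreover have "u \<notin> max_core ?h"
  proof -
    obtain t where t: "t \<in> same h u" "t \<noteq> v" using other_same[OF v(1)] by metis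
    have "t \<noteq> u" "t \<noteq> w" using t nadj' irrefl by (auto simp: same_def)
    then show ?thesis
      using t N neq nz uw by (intro not_in_max_core[of v _ t]) (auto simp: wt same_def intro: sym)
  qed
  moreover have "w \<notin> max_core ?h"
  proof -
    obtain t where t: "t \<in> same h w" "t \<noteq> v" using other_same[OF v(2)] by metis
    have "t \<noteq> w" "t \<noteq> u" using t nadj irrefl by (auto simp: same_def)
    then show ?thesis
      using t N neq nz uw by (intro not_in_max_core[of v _ t]) (auto simp: wt same_def intro: sym)
  qed
  moreover have "v \<notin> max_core ?h"
    using N neq nz uw by (intro not_in_max_core[of u _ w]) (auto simp: wt)
  ultimately show False by blast
qed

section \<open>Triangles in the largest core\<close>

text \<open>The flip separates \<open>a\<close> from \<open>c\<close>, so \<open>a\<close> can stay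
  in the largest core only together with both \<open>b\<close> and its third neighbour
  \<open>r\<close>. Then \<open>r\<close> needs a partner \<open>t\<close> other than
  \<open>a\<close>; its sum is the old one unless \<open>t = b\<close>, whence the final
  disjunction.\<close>

lemma triangle_flip:
  assumes bin: "binary h" and N: "b \<in> N a" "c \<in> N a" "c \<in> N b"
    and wts: "wt h b = wt h a" "wt h c = wt h a"
    and a: "a \<in> max_core (flip a b h)"
  shows "b \<in> max_core (flip a b h) \<and> (\<exists>r\<in>N a. r \<noteq> b \<and> r \<noteq> c \<and>
    wt h r = wt h a + (1 - 2 * h {a, b}) \<and> (\<exists>t\<in>N r. t \<noteq> a \<and> (t = b \<or> wt h t = wt h r)))"
proof -
  let ?h = "flip a b h"
  have neq: "a \<noteq> b" "a \<noteq> c" "b \<noteq> c" using N irrefl by auto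
  note wt = wt_flip[OF N(1), of h]
  have nz: "1 - 2 * h {a, b} \<noteq> 0" using binaryD[OF bin, of "{a, b}"] by auto
  obtain p q where pq: "p \<noteq> q" "p \<in> max_core ?h" "p \<in> same ?h a" "q \<in> max_core ?h" "q \<in> same ?h a"
    using a by (rule max_coreE)
  have c: "c \<notin> same ?h a" using neq nz wts by (auto simp: same_def wt)
  have pqN: "p \<in> N a" "q \<in> N a" using pq by (auto simp: same_def)
  obtain r where r: "r \<in> {p, q}" "r \<noteq> b" using pq by blast
  then have rN: "r \<in> N a" "r \<noteq> c" "r \<in> max_core ?h" "wt ?h r = wt ?h a"
    using pq c by (auto simp: same_def)
  then have "r \<noteq> a" using irrefl by auto
  have "N a = {b, c, r}"
    using N rN r neq by (intro N_eq_three) auto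
  moreover have "p \<noteq> c" "q \<noteq> c" using pq c by auto
  ultimately have "b \<in> {p, q}" using pq(1) pqN by auto
  then have b: "b \<in> max_core ?h" using pq by auto
  obtain t where t: "t \<in> same ?h r" "t \<noteq> a" using other_same[OF rN(3)] by metis
  have "t \<in> N r" "t = b \<or> wt h t = wt h r"
    using t r \<open>r \<noteq> a\<close> by (auto simp: same_def wt split: if_splits)
  moreover have "wt h r = wt h a + (1 - 2 * h {a, b})"
    using rN r \<open>r \<noteq> a\<close> by (simp add: wt)
  ultimately show ?thesis using b r rN t(2) by blast
qed

lemma flip_commute: "flip u v h = flip v u h"
  by (simp add: flip_def insert_commute)

lemma optimal_triangle:
  assumes opt: "optimal h" and N: "b \<in> N a" "c \<in> N a" "c \<in> N b"
    and wts: "wt h b = wt h a" "wt h c = wt h a"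
    and a: "a \<in> max_core h"
  obtains r t where "r \<in> N a" "r \<noteq> b" "r \<noteq> c" "wt h r = wt h a + (1 - 2 * h {a, b})"
    "t \<in> N r" "t \<noteq> a" "t = b \<or> wt h t = wt h r"
proof -
  have bin: "binary h" using opt by (simp add: optimal_def)
  have wtD: "wt (flip a b h) x = wt h x" if "x \<notin> {a, b}" for x
    using that by (auto simp: wt_flip[OF N(1)])
  have "\<exists>x\<in>{a, b}. x \<in> max_core (flip a b h)"
    by (rule optimal_change[OF opt _ wtD, where z = a]) (use a bin in \<open>auto intro: binary_flip\<close>)
  \<comment> \<open>If \<open>b\<close> is the vertex found, \<open>triangle_flip\<close> with
    \<open>a\<close> and \<open>b\<close> exchanged puts \<open>a\<close> into the new core as
    well.\<close>
  then have "a \<in> max_core (flip a b h)"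
    using triangle_flip[OF bin, of a b c] N wts sym[OF N(1)] by (auto simp: flip_commute)
  then show thesis
    using triangle_flip[OF bin N wts] that by blast
qed

text \<open>If \<open>r\<close> and \<open>s\<close> differ, \<open>r\<close> is not adjacent to
  \<open>b\<close>, so \<open>optimal_triangle\<close> gives \<open>r\<close> a neighbour
  \<open>t\<close> other than \<open>a\<close> with the sum of \<open>r\<close>. Flipping the edge
  \<open>{a, r}\<close> separates \<open>a\<close> from \<open>b\<close> and \<open>c\<close>, and
  \<open>r\<close> from \<open>t\<close>. It shifts \<open>a\<close> and \<open>r\<close> equally,
  so these two still differ, and both leave the core.\<close>

lemma optimal_triangle_third_eq:
  assumes opt: "optimal h" and N: "b \<in> N a" "c \<in> N a" "c \<in> N b"
    and wts: "wt h b = wt h a" "wt h c = wt h a"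
    and a: "a \<in> max_core h"
    and r: "r \<in> N a" "r \<noteq> b" "r \<noteq> c" and s: "s \<in> N b" "s \<noteq> a" "s \<noteq> c"
  shows "r = s"
proof (rule ccontr)
  assume "r \<noteq> s"
  have bin: "binary h" using opt by (simp add: optimal_def)
  have neq: "a \<noteq> b" "a \<noteq> c" "b \<noteq> c" "r \<noteq> a" using N r irrefl by auto
  have Na: "N a = {b, c, r}" using N r neq by (intro N_eq_three) auto
  have Nb: "N b = {a, c, s}" using N s neq sym irrefl by (intro N_eq_three) auto
  obtain r' t where r': "r' \<in> N a" "r' \<noteq> b" "r' \<noteq> c" "wt h r' = wt h a + (1 - 2 * h {a, b})"
    "t \<in> N r'" "t \<noteq> a" "t = b \<or> wt h t = wt h r'"
    using optimal_triangle[OF opt N wts a] .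
  have [simp]: "r' = r" using r' Na by blast
  have "t \<noteq> b"
  proof
    assume "t = b"
    then have "r \<in> N b" using r' sym by simp
    then show False using Nb r neq \<open>r \<noteq> s\<close> by blast
  qed
  then have t: "t \<in> N r" "t \<noteq> a" "t \<noteq> r" "wt h t = wt h r" using r' irrefl by auto
  note wt = wt_flip[OF r(1), of h]
  have nz: "1 - 2 * h {a, r} \<noteq> 0" "1 - 2 * h {a, b} \<noteq> 0"
    using binaryD[OF bin, of "{a, r}"] binaryD[OF bin, of "{a, b}"] by auto
  have wtD: "wt (flip a r h) x = wt h x" if "x \<notin> {a, r}" for x
    using that by (auto simp: wt)
  have "\<exists>x\<in>{a, r}. x \<in> max_core (flip a r h)"
    by (rule optimal_change[OF opt _ wtD, where z = a]) (use a bin in \<open>auto intro: binary_flip\<close>)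
  moreover have "a \<notin> max_core (flip a r h)"
    using N neq r wts nz by (intro not_in_max_core[of b _ c]) (auto simp: wt)
  moreover have "r \<notin> max_core (flip a r h)"
    using t neq r r'(4) nz sym[OF r(1)] by (intro not_in_max_core[of a _ t]) (auto simp: wt)
  ultimately show False by blast
qed

text \<open>Each of the six edges is counted at both of its ends.\<close>

lemma K4_parity:
  assumes "N u = {v, w, z}" "N v = {u, w, z}" "N w = {u, v, z}" "N z = {u, v, w}"
  shows "even (wt h u + wt h v + wt h w + wt h z)"
proof -
  have "u \<noteq> v" "u \<noteq> w" "u \<noteq> z" "v \<noteq> w" "v \<noteq> z" "w \<noteq> z"
    using irrefl[of u] irrefl[of v] irrefl[of w] irrefl[of z] unfolding assms by auto
  then have "wt h u + wt h v + wt h w + wt h z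
      = 2 * (h {u, v} + h {u, w} + h {u, z} + h {v, w} + h {v, z} + h {w, z})"
    unfolding wt_def assms by (simp add: insert_commute)
  then show ?thesis by simp
qed

lemma optimal_max_core_empty:
  assumes opt: "optimal h"
  shows "max_core h = {}"
proof (rule ccontr)
  assume "max_core h \<noteq> {}"
  then obtain v where v: "v \<in> max_core h" by blast
  then obtain u w where uw: "u \<noteq> w" "u \<in> max_core h" "u \<in> same h v" "w \<in> max_core h" "w \<in> same h v"
    by (rule max_coreE)
  have N: "u \<in> N v" "w \<in> N v" "u \<in> N w"
    using uw optimal_adjacent[OF opt uw(2,4,3,5,1)] by (auto simp: same_def)
  note N' = N[THEN sym]
  have wts: "wt h u = wt h v" "wt h w = wt h v" using uw by (auto simp: same_def)
  \<comment> \<open>The sum is recorded for \<open>u'\<close> alone: its odd difference from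
    \<open>wt h u\<close> settles the parity at the end.\<close>
  obtain u' where u': "u' \<in> N u" "u' \<noteq> v" "u' \<noteq> w" "wt h u' = wt h u + (1 - 2 * h {u, v})"
    using optimal_triangle[OF opt N'(1,3) N(2)] uw(2) wts by metis
  obtain v' where v': "v' \<in> N v" "v' \<noteq> u" "v' \<noteq> w"
    using optimal_triangle[OF opt N(1,2) N'(3)] v wts by metis
  obtain w' where w': "w' \<in> N w" "w' \<noteq> u" "w' \<noteq> v"
    using optimal_triangle[OF opt N(3) N'(2,1)] uw(4) wts by metis
  have wts': "wt h v = wt h u" "wt h w = wt h u" using wts by simp_all
  have "u' = v'"
    by (rule optimal_triangle_third_eq[OF opt N'(1,3) N(2) wts' uw(2) u'(1-3) v'])
  moreover have "u' = w'"
    by (rule optimal_triangle_third_eq[OF opt N'(3,1) N'(2) wts'(2,1) uw(2) u'(1,3,2) w'])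
  ultimately have z: "u' \<in> N u" "u' \<in> N v" "u' \<in> N w" using u' v' w' by auto
  have neq: "distinct [u, v, w, u']" using N z irrefl uw(1) by auto
  have "N u = {v, w, u'}" "N v = {u, w, u'}" "N w = {u, v, u'}" "N u' = {u, v, w}"
    by (rule N_eq_three; use N N' z z[THEN sym] neq in auto)+
  \<comment> \<open>Three of the sums equal \<open>wt h v\<close> and the fourth differs from it by
    an odd number, so the total is odd.\<close>
  from K4_parity[OF this, of h] show False
    using u'(4) wts by presburger
qed

end

section \<open>Arcs and vertices of directed cycles\<close>

lemma cas_tail_nth:
  assumes "pre_digraph.cas G u p v" "i < length p"
  shows "tail G (p ! i) = (if i = 0 then u else head G (p ! (i - 1)))"
  using assms
proof (induction p arbitrary: u i)
  case Nil
  then show ?case by simp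
next
  case (Cons e p)
  then show ?case
    by (cases i) (auto simp: pre_digraph.cas.simps nth_Cons' split: if_splits)
qed

text \<open>A cycle has distinct vertices after the first one; this turns the condition into
  distinctness of the heads.\<close>

lemma awalk_verts_eq_heads:
  "pre_digraph.cas G u p v \<Longrightarrow> pre_digraph.awalk_verts G u p = u # map (head G) p"
  by (induction p arbitrary: u) (auto simp: pre_digraph.cas.simps pre_digraph.awalk_verts.simps)

lemma cas_last:
  "pre_digraph.cas G u p v \<Longrightarrow> p \<noteq> [] \<Longrightarrow> v = head G (last p)"
  by (induction p arbitrary: u) (auto simp: pre_digraph.cas.simps split: if_splits)

text \<open>Predecessor and successor of the head of \<open>e\<close> on the cycle are the two
  distinct neighbours that \<open>core\<close> asks for.\<close>

lemma cycle_two_neighbours: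
  assumes cyc: "pre_digraph.cycle G p" and len: "length p \<ge> 3" and e: "e \<in> set p"
  obtains e' where "e' \<in> set p" "tail G e' = head G e" "head G e' \<noteq> tail G e"
    "tail G e \<in> head G ` set p"
proof -
  obtain u where u: "pre_digraph.cas G u p u" "distinct (map (head G) p)" "set p \<subseteq> arcs G"
    using cyc awalk_verts_eq_heads[of G]
    by (fastforce simp: pre_digraph.cycle_def pre_digraph.awalk_def)
  let ?n = "length p"
  have last: "u = head G (p ! (?n - 1))"
    using cas_last[OF u(1)] len last_conv_nth[of p] by fastforce
  obtain i where i: "i < ?n" "e = p ! i" using e by (metis in_set_conv_nth)
  \<comment> \<open>Cyclic successor and predecessor of position \<open>i\<close>; they differ
    because the length is at least 3.\<close>
  define j where "j = (if i + 1 = ?n then 0 else i + 1)"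
  define k where "k = (if i = 0 then ?n - 1 else i - 1)"
  have jk: "j < ?n" "k < ?n" "j \<noteq> k" using i len by (auto simp: j_def k_def)
  have "tail G (p ! j) = head G e"
    using cas_tail_nth[OF u(1) jk(1)] last i
    by (cases "i = ?n - 1") (auto simp: j_def)
  moreover have te: "tail G e = head G (p ! k)"
    using cas_tail_nth[OF u(1) i(1)] last i by (auto simp: k_def)
  moreover have "head G (p ! j) \<noteq> head G (p ! k)"
    using u(2) jk by (simp add: distinct_conv_nth)
  ultimately show thesis using that[of "p ! j"] jk by auto
qed

section \<open>Transfer between the given graph and label sums\<close>

theorem theorem4p4:
  fixes G :: "'a pair_pre_digraph"
  assumes "pair_graph G"
    and "max_degree G \<le> 3"
  shows "\<exists>l. two_labelling G l \<and>
    (\<forall>x\<ge>1. undirected_forest (with_proj G \<restriction> product_class G l x))"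
proof -
  interpret pair_graph G by fact
  have symG: "(a, b) \<in> parcs G \<Longrightarrow> (b, a) \<in> parcs G" for a b
    using pair_sym_arcs by (auto simp: symmetric_def sym_def)
  define N where "N v = {u. (v, u) \<in> parcs G}" for v
  have incident: "incident_edges G v = (\<lambda>u. {v, u}) ` N v" for v
    by (auto simp: incident_edges_def edges_def N_def insert_commute dest: symG)
  have inj: "inj_on (\<lambda>u. {v, u}) (N v)" for v
    by (auto simp: inj_on_def doubleton_eq_iff)
  have N_verts: "v \<in> pverts G" if "u \<in> N v" for u v
    using that arc_fst_in_verts by (fastforce simp: N_def)
  have fin: "finite (N v)" for v
    by (rule finite_subset[OF _ finite_imageI[OF pair_finite_arcs, of snd]]) (force simp: N_def)
  have "card (N v) \<le> 3" for v
  proof (cases "v \<in> pverts G")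
    case True
    have "card (N v) = out_degree (with_proj G) v"
      unfolding out_degree_eq_card_incident_edges[OF assms(1)] incident by (simp add: card_image inj)
    also have "\<dots> \<le> max_degree G"
      unfolding max_degree_def using True pair_finite_verts by (intro cSUP_upper) auto
    finally show ?thesis using assms(2) by simp
  next
    case False
    then have "N v = {}" using N_verts by blast
    then show ?thesis by simp
  qed
  then interpret subcubic N
  proof unfold_locales
    show "finite {v. N v \<noteq> {}}"
      using N_verts by (intro finite_subset[OF _ pair_finite_verts]) auto
  qed (use fin in \<open>auto simp: N_def dest: symG pair_no_loops\<close>)
  obtain h where opt: "optimal h" using optimal_exists by blast
  then have bin: "binary h" by (simp add: optimal_def)
  \<comment> \<open>Powers of 2 make the sum \<open>wt h v\<close> the exponent of the vertex
    product.\<close>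
  define l :: "'a set \<Rightarrow> nat" where "l e = 2 ^ nat (h e)" for e
  have h_nonneg: "0 \<le> h e" and "l e \<in> {1, 2}" for e
    using binaryD[OF bin, of e] by (auto simp: l_def)
  then have "two_labelling G l"
    by (simp add: two_labelling_def)
  moreover have "undirected_forest (with_proj G \<restriction> product_class G l x)" for x
    unfolding undirected_forest_def
  proof
    let ?H = "with_proj G \<restriction> product_class G l x"
    have lp: "label_product G l v = 2 ^ nat (wt h v)" for v
    proof -
      have "label_product G l v = (\<Prod>u\<in>N v. l {v, u})"
        unfolding label_product_def incident by (simp add: prod.reindex inj)
      also have "\<dots> = 2 ^ (\<Sum>u\<in>N v. nat (h {v, u}))"
        by (simp add: l_def power_sum)
      also have "(\<Sum>u\<in>N v. nat (h {v, u})) = nat (int (\<Sum>u\<in>N v. nat (h {v, u})))"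
        by (rule nat_int[symmetric])
      also have "int (\<Sum>u\<in>N v. nat (h {v, u})) = wt h v"
        by (simp add: wt_def h_nonneg)
      finally show ?thesis .
    qed
    \<comment> \<open>Nonnegative sums are determined by their \<open>nat\<close> values, so equal
      products force equal sums.\<close>
    have nonneg: "wt h v \<ge> 0" for v
      unfolding wt_def by (intro sum_nonneg h_nonneg)
    have wt_eq: "wt h a = wt h b" if "a \<in> product_class G l x" "b \<in> product_class G l x" for a b
      using that nonneg[of a] nonneg[of b] by (auto simp: product_class_def lp)
    assume "\<exists>p. pre_digraph.cycle ?H p \<and> 3 \<le> length p"
    then obtain p where p: "pre_digraph.cycle ?H p" "3 \<le> length p" by blast
    then have arcs: "e \<in> parcs G" "fst e \<in> product_class G l x" "snd e \<in> product_class G l x"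
      if "e \<in> set p" for e
      using that by (auto simp: pre_digraph.cycle_def pre_digraph.awalk_def)
    \<comment> \<open>The heads of the arcs are the vertices of the cycle, and all lie in one
      product class.\<close>
    have "core h (snd ` set p)"
      unfolding core_def
    proof
      fix y assume "y \<in> snd ` set p"
      then obtain e where e: "e \<in> set p" "y = snd e" by blast
      from p e(1) obtain e' where e': "e' \<in> set p" "fst e' = snd e" "snd e' \<noteq> fst e"
          "fst e \<in> snd ` set p"
        using cycle_two_neighbours[of ?H p e] by auto
      have "fst e \<in> N y" "snd e' \<in> N y"
        using e(2) e'(2) symG[of "fst e" "snd e"] arcs(1)[OF e(1)] arcs(1)[OF e'(1)]
        by (simp_all add: N_def) (metis prod.collapse)
      moreover have "wt h (fst e) = wt h y" "wt h (snd e') = wt h y"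
        unfolding e(2) by (rule wt_eq; use e e' arcs in blast)+
      ultimately have "fst e \<in> same h y" "snd e' \<in> same h y"
        by (simp_all add: same_def)
      then show "\<exists>a b. a \<noteq> b \<and> a \<in> snd ` set p \<inter> same h y \<and> b \<in> snd ` set p \<inter> same h y"
        using e'(1,3,4) by (intro exI[of _ "fst e"] exI[of _ "snd e'"]) auto
    qed
    then have "snd ` set p \<subseteq> max_core h"
      by (rule core_subset)
    then have "snd ` set p = {}"
      unfolding optimal_max_core_empty[OF opt] by (rule subset_empty[THEN iffD1])
    then show False using p(2) by simp
  qed
  ultimately show ?thesis by blast
qed

end
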